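(* The set $\mathcal D$ of long-term voltage stable operating points, its closure $\operatorname{cl}(\mathcal D)$ and its boundary $\partial\mathcal D$ are parametrized by $$\mathcal D = \{\, g(\mu)^{-1}[\mu](\mathcal I_L^* + r\mathbf 1) \;:\; \mu\in\mathcal M_1,\ r>0 \,\},$$ $$\operatorname{cl}(\mathcal D) = \{\, g(\mu)^{-1}[\mu](\mathcal I_L^* + r\mathbf 1) \;:\; \mu\in\mathcal M_1,\ r\ge 0 \,\},$$ $$\partial\mathcal D = \{\, g(\mu)^{-1}[\mu]\mathcal I_L^* \;:\; \mu\in\mathcal M_1 \,\}.$$ Furthermore, the map $(\mu,r)\mapsto g(\mu)^{-1}[\mu](\mathcal I_L^*+r\mathbf 1)$ from $\mathcal M_1\times\mathbb R_{\ge 0}$ to $\operatorname{cl}(\mathcal D)$ is a bicontinuous map (a homeomorphism).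
   Context: Notation: $[x]=\operatorname{diag}(x_1,\dots,x_k)$ for a vector $x$; $\mathbf 1,\mathbf 0$ are the all-ones and all-zeros vectors; vector and matrix inequalities are element-wise; $\|\cdot\|_1$ is the 1-norm. A Z-matrix is a real square matrix with nonpositive off-diagonal entries; an M-matrix is a Z-matrix all of whose eigenvalues have nonnegative real part. Setting: a DC power grid with $n\ge1$ loads and $m\ge1$ sources. Its Kirchhoff matrix $Y=\begin{pmatrix} Y_{LL} & Y_{LS} \\ Y_{SL} & Y_{SS} \end{pmatrix}\in\mathbb R^{(n+m)\times(n+m)}$ is the weighted Laplacian of a connected undirected graph with positive edge weights (symmetric, nonpositive off-diagonal entries, zero row sums), partitioned according to loads and sources, and the $n\times n$ matrix $Y_{LL}$ is irreducible; hence $Y_{LL}$ is a symmetric positive definite irreducible nonsingular M-matrix. The source voltages $V_S\in\mathbb R^m$, $V_S>\mathbf 0$, are fixed. Put $\mathcal I_L^*=-Y_{LS}V_S$ (which satisfies $\mathcal I_L^*\ge\mathbf 0$, $\mathcal I_L^*\ne\mathbf 0$) and $V_L^*=Y_{LL}^{-1}\mathcal I_L^*$ (which satisfies $V_L^*>\mathbf 0$). For $V_L\in\mathbb R^n$ put $P_c(V_L)=[V_L]Y_{LL}(V_L^*-V_L)$, with Jacobian $\frac{\partial P_c}{\partial V_L}(V_L)=[Y_{LL}(V_L^*-V_L)]-[V_L]Y_{LL}$. $\mathcal D$ is the set of all $V_L>\mathbf 0$ such that $\frac{\partial P_c}{\partial V_L}(V_L)$ is nonsingular and its inverse has only negative entries;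 $\operatorname{cl}(\mathcal D)$ and $\partial\mathcal D$ are its closure and boundary in $\mathbb R^n$. For $\mu\in\mathbb R^n$ put $g(\mu)=[\mu]Y_{LL}+[Y_{LL}\mu]$. $\mathcal M=\{\mu\in\mathbb R^n: g(\mu)\text{ is a nonsingular M-matrix}\}$ and $\mathcal M_1=\{\mu\in\mathcal M:\|\mu\|_1=1\}$ (elements of $\mathcal M$ are positive vectors). *)

theory Defs
  imports "HOL-Analysis.Analysis"
begin

section \<open>Matrix notions\<close>

definition diag_of :: "real^'n \<Rightarrow> real^'n^'n" where
  "diag_of x = (\<chi> i j. if i = j then x $ i else 0)"

definition norm_1 :: "real^'n \<Rightarrow> real" where
  "norm_1 x = (\<Sum>i\<in>UNIV. \<bar>x $ i\<bar>)"

text \<open>Entrywise strict positivity. The library order \<open><\<close> on vectors is not entrywise: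
  it means \<open>\<le>\<close> together with \<open>\<noteq>\<close>.\<close>

definition pos_vec :: "real^'n \<Rightarrow> bool" where
  "pos_vec x \<longleftrightarrow> (\<forall>i. 0 < x $ i)"

definition neg_matrix :: "real^'n^'m \<Rightarrow> bool" where
  "neg_matrix A \<longleftrightarrow> (\<forall>i j. A $ i $ j < 0)"

text \<open>The complex eigenvalues of a real square matrix.\<close>

definition eigenvalue_of :: "real^'n^'n \<Rightarrow> complex \<Rightarrow> bool" where
  "eigenvalue_of A z \<longleftrightarrow>
     (\<exists>v::complex^'n. v \<noteq> 0 \<and> map_matrix complex_of_real A *v v = z *s v)"

definition Z_matrix :: "real^'n^'n \<Rightarrow> bool" where
  "Z_matrix A \<longleftrightarrow> (\<forall>i j. i \<noteq> j \<longrightarrow> A $ i $ j \<le> 0)"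

definition M_matrix :: "real^'n^'n \<Rightarrow> bool" where
  "M_matrix A \<longleftrightarrow> Z_matrix A \<and> (\<forall>z. eigenvalue_of A z \<longrightarrow> 0 \<le> Re z)"

text \<open>A matrix is reducible if a simultaneous permutation of its rows and columns makes it
  block triangular with square diagonal blocks, i.e. if for some nonempty proper index set \<open>S\<close>
  the block with rows in \<open>S\<close> and columns outside \<open>S\<close> vanishes.
  In particular every \<open>1 \<times> 1\<close> matrix is irreducible.\<close>

definition irreducible_matrix :: "real^'n^'n \<Rightarrow> bool" where
  "irreducible_matrix A \<longleftrightarrow>
     \<not> (\<exists>S. S \<noteq> {} \<and> S \<noteq> UNIV \<and> (\<forall>i\<in>S. \<forall>j\<in>-S. A $ i $ j = 0))"

section \<open>The power grid\<close>

text \<open>Weighted Laplacian of a connected undirected graph with positive edge weights;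
  distinct nodes \<open>i\<close> and \<open>j\<close> are adjacent iff the entry at \<open>(i, j)\<close> is nonzero, and that entry
  is minus the weight of the edge.\<close>

definition kirchhoff_matrix :: "real^'k^'k \<Rightarrow> bool" where
  "kirchhoff_matrix Y \<longleftrightarrow>
     transpose Y = Y \<and>
     (\<forall>i j. i \<noteq> j \<longrightarrow> Y $ i $ j \<le> 0) \<and>
     (\<forall>i. (\<Sum>j\<in>UNIV. Y $ i $ j) = 0) \<and>
     (\<forall>i j. (i, j) \<in> {(a, b). a \<noteq> b \<and> Y $ a $ b \<noteq> 0}\<^sup>*)"

text \<open>The nodes form the type \<open>'n + 'm\<close>: loads are tagged by \<open>Inl\<close>, sources by \<open>Inr\<close>.\<close>

definition Y_LL :: "real^('n::finite + 'm::finite)^('n + 'm) \<Rightarrow> real^'n^'n" where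
  "Y_LL Y = (\<chi> i j. Y $ Inl i $ Inl j)"

definition Y_LS :: "real^('n::finite + 'm::finite)^('n + 'm) \<Rightarrow> real^'m^'n" where
  "Y_LS Y = (\<chi> i j. Y $ Inl i $ Inr j)"

definition I_star :: "real^('n::finite + 'm::finite)^('n + 'm) \<Rightarrow> real^'m \<Rightarrow> real^'n" where
  "I_star Y V\<^sub>S = - (Y_LS Y *v V\<^sub>S)"

definition V_star :: "real^('n::finite + 'm::finite)^('n + 'm) \<Rightarrow> real^'m \<Rightarrow> real^'n" where
  "V_star Y V\<^sub>S = matrix_inv (Y_LL Y) *v I_star Y V\<^sub>S"

definition P_c :: "real^('n::finite + 'm::finite)^('n + 'm) \<Rightarrow> real^'m \<Rightarrow> real^'n \<Rightarrow> real^'n" where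
  "P_c Y V\<^sub>S V = diag_of V *v (Y_LL Y *v (V_star Y V\<^sub>S - V))"

definition stable_set :: "real^('n::finite + 'm::finite)^('n + 'm) \<Rightarrow> real^'m \<Rightarrow> (real^'n) set" where
  "stable_set Y V\<^sub>S =
     {V. pos_vec V \<and> invertible (jacobian (P_c Y V\<^sub>S) (at V)) \<and>
         neg_matrix (matrix_inv (jacobian (P_c Y V\<^sub>S) (at V)))}"

definition g :: "real^('n::finite + 'm::finite)^('n + 'm) \<Rightarrow> real^'n \<Rightarrow> real^'n^'n" where
  "g Y \<mu> = diag_of \<mu> ** Y_LL Y + diag_of (Y_LL Y *v \<mu>)"

definition M_set :: "real^('n::finite + 'm::finite)^('n + 'm) \<Rightarrow> (real^'n) set" where
  "M_set Y = {\<mu>. invertible (g Y \<mu>) \<and> M_matrix (g Y \<mu>)}"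

definition M1_set :: "real^('n::finite + 'm::finite)^('n + 'm) \<Rightarrow> (real^'n) set" where
  "M1_set Y = {\<mu> \<in> M_set Y. norm_1 \<mu> = 1}"

lemma diag_of_mult_vec: "diag_of x *v y = (\<chi> i. x $ i * y $ i)"
  by (simp add: diag_of_def matrix_vector_mult_def vec_eq_iff if_distrib[of "\<lambda>a. a * _"] cong: if_cong)

lemma P_c_has_derivative:
  "(P_c Y V\<^sub>S has_derivative
     (\<lambda>h. (diag_of (Y_LL Y *v (V_star Y V\<^sub>S - V)) - diag_of V ** Y_LL Y) *v h)) (at V)"
proof -
  have *: "((\<lambda>V. V $ i * (Y_LL Y *v (V_star Y V\<^sub>S - V)) $ i) has_derivative
      (\<lambda>h. V $ i * (Y_LL Y *v (- h)) $ i + h $ i * (Y_LL Y *v (V_star Y V\<^sub>S - V)) $ i)) (at V)" for i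
    by (rule has_derivative_mult)
       (auto intro!: derivative_eq_intros bounded_linear.has_derivative[OF bounded_linear_vec_nth]
          bounded_linear.has_derivative[OF matrix_vector_mul_bounded_linear])
  have "((\<lambda>V. \<chi> i. V $ i * (Y_LL Y *v (V_star Y V\<^sub>S - V)) $ i) has_derivative
      (\<lambda>h. \<chi> i. V $ i * (Y_LL Y *v (- h)) $ i + h $ i * (Y_LL Y *v (V_star Y V\<^sub>S - V)) $ i)) (at V)"
    using * by (subst has_derivative_componentwise_within)
      (auto simp: Basis_vec_def inner_axis)
  moreover have "(\<lambda>h. \<chi> i. V $ i * (Y_LL Y *v (- h)) $ i + h $ i * (Y_LL Y *v (V_star Y V\<^sub>S - V)) $ i)
      = (\<lambda>h. (diag_of (Y_LL Y *v (V_star Y V\<^sub>S - V)) - diag_of V ** Y_LL Y) *v h)"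
    by (rule ext) (simp add: matrix_vector_mult_diff_rdistrib diag_of_mult_vec
        matrix_vector_mul_assoc[symmetric] vec_eq_iff linear_neg[OF matrix_vector_mul_linear] mult.commute)
  ultimately show ?thesis
    unfolding P_c_def diag_of_mult_vec by simp
qed

lemma jacobian_P_c:
  "jacobian (P_c Y V\<^sub>S) (at V) = diag_of (Y_LL Y *v (V_star Y V\<^sub>S - V)) - diag_of V ** Y_LL Y"
  unfolding jacobian_def frechet_derivative_at[OF P_c_has_derivative, symmetric]
  by (rule matrix_of_matrix_vector_mul)

end

theory Submission
  imports Defs
begin

text \<open>
  Write \<open>A\<close> for \<open>Y_LL Y\<close>, \<open>b\<close> for \<open>I_star Y V\<^sub>S\<close> and \<open>J(V)\<close> for the Jacobian of \<open>P_c\<close>.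
  The equation \<open>g(\<mu>) V = [\<mu>](b + r 1)\<close> is equivalent to \<open>- J(V) \<mu> = r \<mu>\<close>, and for \<open>V > 0\<close> the
  matrix \<open>- J(V)\<close> is an irreducible Z-matrix. Hence \<open>(\<mu>, r)\<close> is the normalized Perron pair of
  \<open>- J(V)\<close>, which is unique and depends continuously on \<open>V\<close>, and \<open>V\<close> is stable exactly if \<open>r > 0\<close>.
  Conversely, \<open>g(\<mu>)\<close> maps the positive vector \<open>V\<close> to a nonnegative nonzero vector, which for an
  irreducible Z-matrix characterizes the nonsingular M-matrices. Points on the image satisfy
  \<open>b\<^sub>i + r \<le> A\<^sub>i\<^sub>i V\<^sub>i + (A V)\<^sub>i\<close>; this keeps limits of them away from the boundary of the positive
  orthant, so that the parametrization is a closed map.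
\<close>

section \<open>Z-matrices\<close>

lemma matrix_vector_mult_diag_split:
  fixes G :: "real^'n^'n"
  shows "(G *v z) $ i = G $ i $ i * z $ i + (\<Sum>j\<in>-{i}. G $ i $ j * z $ j)"
  by (simp add: matrix_vector_mult_def sum.remove[of UNIV i] Compl_eq_Diff_UNIV)

lemma Z_matrix_mult_le:
  fixes G :: "real^'n^'n"
  assumes "Z_matrix G" and "\<And>i. 0 \<le> z $ i"
  shows "(G *v z) $ i \<le> G $ i $ i * z $ i"
proof -
  have "(\<Sum>j\<in>-{i}. G $ i $ j * z $ j) \<le> 0"
    using assms by (intro sum_nonpos mult_nonpos_nonneg) (auto simp: Z_matrix_def)
  thus ?thesis
    by (simp add: matrix_vector_mult_diag_split)
qed

text \<open>Let \<open>S\<close> be the zero set of \<open>z\<close>. In a row \<open>i\<close> of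
  \<open>S\<close>, \<open>(G *v z) $ i\<close> is a sum of nonpositive off-diagonal terms, so its
  nonnegativity makes each of them vanish. Then the block of \<open>G\<close> from \<open>S\<close>
  to \<open>-S\<close> is zero, which irreducibility permits only for \<open>S = {}\<close>.\<close>

lemma irreducible_Z_matrix_pos_vec:
  fixes G :: "real^'n^'n"
  assumes irr: "irreducible_matrix G" and Z: "Z_matrix G"
    and nonneg: "\<And>i. 0 \<le> z $ i" and zeros: "\<And>i. z $ i = 0 \<Longrightarrow> 0 \<le> (G *v z) $ i"
    and "z \<noteq> 0"
  shows "pos_vec z"
proof (rule ccontr)
  define S where "S = {i. z $ i = 0}"
  assume "\<not> pos_vec z"
  hence "S \<noteq> {}"
    using nonneg by (force simp: pos_vec_def S_def less_le)
  moreover have "S \<noteq> UNIV"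
    using \<open>z \<noteq> 0\<close> by (auto simp: S_def vec_eq_iff)
  moreover have "G $ i $ j = 0" if "i \<in> S" "j \<in> -S" for i j
  proof -
    have le: "G $ i $ k * z $ k \<le> 0" if "k \<in> -{i}" for k
      using Z nonneg that by (intro mult_nonpos_nonneg) (auto simp: Z_matrix_def)
    have "0 \<le> (\<Sum>k\<in>-{i}. G $ i $ k * z $ k)"
      using zeros[of i] \<open>i \<in> S\<close> by (simp add: S_def matrix_vector_mult_diag_split)
    hence "(\<Sum>k\<in>-{i}. G $ i $ k * z $ k) = 0"
      using le sum_nonpos[of "-{i}" "\<lambda>k. G $ i $ k * z $ k"] by force
    hence "(\<Sum>k\<in>-{i}. - (G $ i $ k * z $ k)) = 0"
      by (simp add: sum_negf)
    hence "\<forall>k\<in>-{i}. - (G $ i $ k * z $ k) = 0"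
      using le by (subst (asm) sum_nonneg_eq_0_iff) auto
    moreover have "j \<noteq> i" "z $ j \<noteq> 0"
      using that by (auto simp: S_def)
    ultimately show ?thesis
      by auto
  qed
  ultimately show False
    using irr by (auto simp: irreducible_matrix_def)
qed

text \<open>Positive row scaling keeps the zero pattern. The diagonal of \<open>G\<close> is left
  free, so that both \<open>g Y \<mu>\<close> and \<open>neg_jac V\<close> are covered.\<close>

lemma irreducible_matrix_off_diag_scaled:
  fixes A G :: "real^'n^'n"
  assumes "irreducible_matrix A" and "pos_vec v"
    and "\<And>i j. i \<noteq> j \<Longrightarrow> G $ i $ j = v $ i * A $ i $ j"
  shows "irreducible_matrix G"
proof -
  have "A $ i $ j = 0" if "i \<in> S" "j \<in> -S" "G $ i $ j = 0" for i j S
  proof -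
    have "i \<noteq> j"
      using that by blast
    hence "v $ i * A $ i $ j = 0"
      using assms(3)[of i j] that(3) by metis
    thus ?thesis
      using assms(2) by (metis less_irrefl mult_eq_0_iff pos_vec_def)
  qed
  thus ?thesis
    using assms(1) unfolding irreducible_matrix_def by meson
qed

lemma Z_matrix_off_diag_scaled:
  fixes A G :: "real^'n^'n"
  assumes "Z_matrix A" and "pos_vec v"
    and "\<And>i j. i \<noteq> j \<Longrightarrow> G $ i $ j = v $ i * A $ i $ j"
  shows "Z_matrix G"
proof -
  have "v $ i * A $ i $ j \<le> 0" if "i \<noteq> j" for i j
    using assms(1,2) that by (intro mult_nonneg_nonpos) (auto simp: Z_matrix_def pos_vec_def less_imp_le)
  thus ?thesis
    unfolding Z_matrix_def by (metis assms(3))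
qed

text \<open>\<open>t\<close> is the least ratio \<open>y $ i / x $ i\<close> and \<open>k\<close> an
  index attaining it. Hence \<open>y - t *\<^sub>R x\<close> is nonnegative with a zero at
  \<open>k\<close>, and that zero contradicts strict positivity in the comparison arguments
  below.\<close>

lemma ex_min_ratio:
  fixes x y :: "real^'n"
  assumes "pos_vec x"
  obtains t k where "\<And>i. t * x $ i \<le> y $ i" and "t * x $ k = y $ k"
proof -
  have "Min (range (\<lambda>i. y $ i / x $ i)) \<in> range (\<lambda>i. y $ i / x $ i)"
    by (rule Min_in) auto
  then obtain k where "Min (range (\<lambda>i. y $ i / x $ i)) = y $ k / x $ k"
    by (rule imageE)
  moreover have "Min (range (\<lambda>i. y $ i / x $ i)) \<le> y $ i / x $ i" for i
    by (rule Min_le) auto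
  ultimately have "y $ k / x $ k \<le> y $ i / x $ i" for i
    by simp
  moreover have "0 < x $ i" for i
    using assms by (simp add: pos_vec_def)
  ultimately show ?thesis
    by (intro that[of "y $ k / x $ k" k]) (auto simp: pos_le_divide_eq less_imp_neq[symmetric])
qed

text \<open>If \<open>t \<le> 0\<close>, then \<open>z = y - t *\<^sub>R x\<close> also has a
  nonnegative image under \<open>G\<close>, so it is zero or strictly positive; its zero at
  \<open>k\<close> leaves \<open>y = t *\<^sub>R x\<close>. A positive entry of
  \<open>G *v x\<close> then forces \<open>t = 0\<close>, against
  \<open>y \<noteq> 0\<close>.\<close>

lemma semipositive_pos_vec:
  fixes G :: "real^'n^'n"
  assumes irr: "irreducible_matrix G" and Z: "Z_matrix G"
    and x: "pos_vec x" "\<And>i. 0 \<le> (G *v x) $ i" "G *v x \<noteq> 0"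
    and y: "\<And>i. 0 \<le> (G *v y) $ i" "y \<noteq> 0"
  shows "pos_vec y"
proof -
  obtain t k where t: "\<And>i. t * x $ i \<le> y $ i" and k: "t * x $ k = y $ k"
    using ex_min_ratio[OF x(1)] by metis
  show ?thesis
  proof (cases "0 < t")
    case True
    have "0 < t * x $ i" for i
      using True x(1) by (simp add: pos_vec_def)
    thus ?thesis
      using t unfolding pos_vec_def by (meson less_le_trans)
  next
    case False
    define z where "z = y - t *\<^sub>R x"
    have Gz: "G *v z = G *v y - t *\<^sub>R (G *v x)"
      by (simp add: z_def matrix_vector_mult_diff_distrib matrix_vector_mult_scaleR)
    have "z = 0"
    proof (rule ccontr)
      assume "z \<noteq> 0"
      have "0 \<le> (G *v z) $ i" for i
        using y(1)[of i] x(2)[of i] False by (simp add: Gz) (smt (verit) mult_nonpos_nonneg)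
      hence "pos_vec z"
        using t \<open>z \<noteq> 0\<close> by (intro irreducible_Z_matrix_pos_vec[OF irr Z]) (auto simp: z_def)
      moreover have "z $ k = 0"
        using k by (simp add: z_def)
      ultimately show False
        by (metis less_irrefl pos_vec_def)
    qed
    hence yx: "y = t *\<^sub>R x"
      by (simp add: z_def)
    obtain i where "(G *v x) $ i \<noteq> 0"
      using x(3) by (auto simp: vec_eq_iff)
    hence "0 < (G *v x) $ i"
      using x(2)[of i] by simp
    moreover have "0 \<le> t * (G *v x) $ i"
      using y(1)[of i] by (simp add: yx matrix_vector_mult_scaleR)
    ultimately have "t = 0"
      using False by (simp add: zero_le_mult_iff)
    thus ?thesis
      using yx y(2) by simp
  qed
qed

section \<open>Nonsingularity and the sign of the inverse\<close>

lemma invertible_iff_ker: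
  fixes G :: "'a::field^'n^'n"
  shows "invertible G \<longleftrightarrow> (\<forall>x. G *v x = 0 \<longrightarrow> x = 0)"
  by (simp add: invertible_left_inverse matrix_left_invertible_ker)

lemma matrix_inv_mult:
  fixes G :: "'a::field^'n^'n"
  assumes "invertible G"
  shows "G ** matrix_inv G = mat 1" "matrix_inv G ** G = mat 1"
  using assms someI_ex[of "\<lambda>B. G ** B = mat 1 \<and> B ** G = mat 1"]
  by (auto simp: invertible_def matrix_inv_def)

lemma matrix_inv_mult_vec_eq_iff:
  fixes G :: "'a::field^'n^'n"
  assumes "invertible G"
  shows "x = matrix_inv G *v y \<longleftrightarrow> G *v x = y"
  using matrix_inv_mult[OF assms]
  by (metis matrix_vector_mul_assoc matrix_vector_mul_lid)

text \<open>For a nonzero kernel vector \<open>y\<close>, \<open>semipositive_pos_vec\<close> would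
  make both \<open>y\<close> and \<open>- y\<close> positive.\<close>

lemma semipositive_invertible:
  fixes G :: "real^'n^'n"
  assumes "irreducible_matrix G" and "Z_matrix G"
    and "pos_vec x" "\<And>i. 0 \<le> (G *v x) $ i" "G *v x \<noteq> 0"
  shows "invertible G"
proof -
  have "y = 0" if "G *v y = 0" for y
  proof (rule ccontr)
    assume "y \<noteq> 0"
    have "pos_vec y"
      by (rule semipositive_pos_vec[OF assms]) (use that \<open>y \<noteq> 0\<close> in auto)
    moreover have "G *v (- y) = 0"
      using that by (simp add: linear_neg[OF matrix_vector_mul_linear])
    hence "pos_vec (- y)"
      by (intro semipositive_pos_vec[OF assms]) (use \<open>y \<noteq> 0\<close> in auto)
    ultimately show False
      by (metis less_asym neg_0_less_iff_less pos_vec_def vector_uminus_component)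
  qed
  thus ?thesis
    by (simp add: invertible_iff_ker)
qed

text \<open>Trades the sign of an inverse for a witness \<open>w\<close>. A negative inverse maps
  \<open>- 1\<close> to such a witness. Conversely, \<open>- J\<close> maps each column of
  \<open>- matrix_inv J\<close> to a unit vector, so \<open>semipositive_pos_vec\<close> makes that
  column positive.\<close>

lemma neg_inverse_iff_semipositive:
  fixes J :: "real^'n^'n"
  assumes irr: "irreducible_matrix (- J)" and Z: "Z_matrix (- J)"
  shows "invertible J \<and> neg_matrix (matrix_inv J) \<longleftrightarrow> (\<exists>w. pos_vec w \<and> pos_vec (- J *v w))"
proof
  assume *: "invertible J \<and> neg_matrix (matrix_inv J)"
  define w where "w = matrix_inv J *v (- 1)"
  have neg: "J *v w = - 1"
    using * matrix_inv_mult_vec_eq_iff[of J w "- 1"] by (simp add: w_def)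
  have "- J *v w = - (J *v w)"
    by (simp add: matrix_vector_mult_def vec_eq_iff sum_negf)
  hence "- J *v w = 1"
    by (simp add: neg)
  moreover have "0 < w $ i" for i
    using * unfolding w_def neg_matrix_def
    by (auto simp: matrix_vector_mult_def intro!: sum_pos)
  ultimately have "pos_vec w \<and> pos_vec (- J *v w)"
    by (simp add: pos_vec_def)
  thus "\<exists>w. pos_vec w \<and> pos_vec (- J *v w)"
    by blast
next
  assume "\<exists>w. pos_vec w \<and> pos_vec (- J *v w)"
  then obtain w where w: "pos_vec w" "pos_vec (- J *v w)"
    by blast
  have w': "\<And>i. 0 \<le> (- J *v w) $ i" "- J *v w \<noteq> 0"
    using w(2) by (auto simp: pos_vec_def vec_eq_iff less_imp_le less_imp_neq[symmetric])
  have neg: "(- J) *v x = J *v (- x)" for x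
    by (simp add: matrix_vector_mult_def vec_eq_iff)
  have "invertible (- J)"
    by (rule semipositive_invertible[OF irr Z w(1) w'])
  hence inv: "invertible J"
    unfolding invertible_iff_ker neg by (metis add.inverse_inverse neg_equal_0_iff_equal)
  have "matrix_inv J $ i $ k < 0" for i k
  proof -
    define y where "y = - (matrix_inv J *v axis k 1)"
    have y: "- J *v y = axis k 1"
      using matrix_inv_mult_vec_eq_iff[OF inv, of "- y" "axis k 1"] by (simp add: neg y_def)
    hence "y \<noteq> 0"
      by (auto simp: axis_eq_0_iff)
    hence "pos_vec y"
      by (intro semipositive_pos_vec[OF irr Z w(1) w']) (auto simp: y axis_def)
    hence "0 < y $ i"
      by (simp add: pos_vec_def)
    thus ?thesis
      by (simp add: y_def matrix_vector_mult_basis column_def)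
  qed
  thus "invertible J \<and> neg_matrix (matrix_inv J)"
    using inv by (simp add: neg_matrix_def)
qed

text \<open>Gershgorin's disc argument in the norm weighted by \<open>x\<close>.\<close>

lemma semipositive_M_matrix:
  fixes G :: "real^'n^'n"
  assumes Z: "Z_matrix G" and x: "pos_vec x" "\<And>i. 0 \<le> (G *v x) $ i"
  shows "M_matrix G"
proof -
  have "0 \<le> Re l" if "eigenvalue_of G l" for l
  proof -
    obtain v where v: "v \<noteq> 0" "map_matrix complex_of_real G *v v = l *s v"
      using \<open>eigenvalue_of G l\<close> by (auto simp: eigenvalue_of_def)
    \<comment> \<open>Here \<open>- t\<close> is the largest weighted modulus
      \<open>norm (v $ i) / x $ i\<close>, attained at \<open>k\<close>; row \<open>k\<close> of the
      eigenvalue equation is the one to estimate.\<close>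
    obtain t k where t: "\<And>i. t * x $ i \<le> - norm (v $ i)" and k: "t * x $ k = - norm (v $ k)"
      using ex_min_ratio[OF x(1), of "\<chi> i. - norm (v $ i)"] by auto
    have xpos: "0 < x $ i" for i
      using x(1) by (simp add: pos_vec_def)
    obtain j where "v $ j \<noteq> 0"
      using v(1) by (auto simp: vec_eq_iff)
    hence "t * x $ j < 0"
      using t[of j] by (smt (verit) zero_less_norm_iff)
    hence "t < 0"
      using xpos[of j] by (simp add: mult_less_0_iff)
    have "(\<Sum>j\<in>UNIV. of_real (G $ k $ j) * v $ j) = l * v $ k"
      using arg_cong[OF v(2), of "\<lambda>u. u $ k"] by (simp add: matrix_vector_mult_def map_matrix_def)
    moreover have "(\<Sum>j\<in>UNIV. of_real (G $ k $ j) * v $ j)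
        = of_real (G $ k $ k) * v $ k + (\<Sum>j\<in>-{k}. of_real (G $ k $ j) * v $ j)"
      by (subst sum.remove[of _ k]) (auto simp: Compl_eq_Diff_UNIV)
    ultimately have "(l - of_real (G $ k $ k)) * v $ k = (\<Sum>j\<in>-{k}. of_real (G $ k $ j) * v $ j)"
      by (simp add: algebra_simps)
    hence "norm (l - of_real (G $ k $ k)) * norm (v $ k)
        = norm (\<Sum>j\<in>-{k}. of_real (G $ k $ j) * v $ j)"
      by (metis norm_mult)
    also have "\<dots> \<le> (\<Sum>j\<in>-{k}. t * (G $ k $ j * x $ j))"
    proof (rule sum_norm_le)
      fix j assume "j \<in> -{k}"
      hence "G $ k $ j \<le> 0"
        using Z by (auto simp: Z_matrix_def)
      hence "G $ k $ j * (- norm (v $ j)) \<le> G $ k $ j * (t * x $ j)"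
        by (rule mult_left_mono_neg[OF t])
      thus "norm (of_real (G $ k $ j) * v $ j) \<le> t * (G $ k $ j * x $ j)"
        using \<open>G $ k $ j \<le> 0\<close> by (simp add: norm_mult mult_ac)
    qed
    also have "\<dots> = t * (G *v x) $ k - t * G $ k $ k * x $ k"
      by (simp add: matrix_vector_mult_diag_split sum_distrib_left algebra_simps)
    also have "\<dots> \<le> G $ k $ k * norm (v $ k)"
    proof -
      have "t * G $ k $ k * x $ k = - (G $ k $ k * norm (v $ k))"
        using k by (metis mult.assoc mult.commute mult_minus_right)
      moreover have "t * (G *v x) $ k \<le> 0"
        using \<open>t < 0\<close> x(2)[of k] by (simp add: mult_nonpos_nonneg)
      ultimately show ?thesis
        by simp
    qed
    finally have "norm (l - of_real (G $ k $ k)) * norm (v $ k) \<le> G $ k $ k * norm (v $ k)" .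
    moreover have "0 < norm (v $ k)"
      using k \<open>t < 0\<close> xpos[of k] by (smt (verit) mult_neg_pos)
    ultimately have "norm (l - of_real (G $ k $ k)) \<le> G $ k $ k"
      by simp
    \<comment> \<open>The disc around \<open>G $ k $ k\<close> of radius \<open>G $ k $ k\<close>
      lies in the closed right half-plane.\<close>
    moreover have "\<bar>Re (l - of_real (G $ k $ k))\<bar> \<le> norm (l - of_real (G $ k $ k))"
      by (rule abs_Re_le_cmod)
    ultimately show ?thesis
      by simp
  qed
  thus ?thesis
    using Z by (simp add: M_matrix_def)
qed

section \<open>Existence and uniqueness of Perron pairs\<close>

lemma convex_probability_vectors: "convex {x::real^'n. (\<forall>i. 0 \<le> x $ i) \<and> (\<Sum>i\<in>UNIV. x $ i) = 1}"
  by (auto simp: convex_def sum.distrib simp flip: sum_distrib_left)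

lemma compact_probability_vectors: "compact {x::real^'n. (\<forall>i. 0 \<le> x $ i) \<and> (\<Sum>i\<in>UNIV. x $ i) = 1}"
proof -
  have "norm x \<le> 1" if "\<forall>i. 0 \<le> x $ i" "(\<Sum>i\<in>UNIV. x $ i) = 1" for x :: "real^'n"
    using norm_le_l1_cart[of x] that by simp
  hence "bounded {x::real^'n. (\<forall>i. 0 \<le> x $ i) \<and> (\<Sum>i\<in>UNIV. x $ i) = 1}"
    unfolding bounded_iff by blast
  moreover have "closed {x::real^'n. (\<forall>i. 0 \<le> x $ i) \<and> (\<Sum>i\<in>UNIV. x $ i) = 1}"
    by (intro closed_Collect_conj closed_Collect_all closed_Collect_le closed_Collect_eq
        continuous_intros)
  ultimately show ?thesis
    by (simp add: compact_eq_bounded_closed)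
qed

text \<open>Brouwer's theorem for \<open>x \<mapsto> C x / \<parallel>C x\<parallel>\<^sub>1\<close> with \<open>C = c I - G\<close> nonnegative with positive diagonal.\<close>

lemma Z_matrix_Perron_vector:
  fixes G :: "real^'n^'n"
  assumes Z: "Z_matrix G"
  obtains \<tau> x where "\<And>i. 0 \<le> x $ i" "(\<Sum>i\<in>UNIV. x $ i) = 1" "G *v x = \<tau> *\<^sub>R x"
proof -
  define K where "K = {x::real^'n. (\<forall>i. 0 \<le> x $ i) \<and> (\<Sum>i\<in>UNIV. x $ i) = 1}"
  \<comment> \<open>The summand 1 makes \<open>c\<close> strictly exceed every diagonal entry, so
    that \<open>s x\<close> is positive on the simplex and the normalization is defined
    there.\<close>
  define c where "c = (\<Sum>i\<in>UNIV. \<bar>G $ i $ i\<bar>) + 1"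
  define C where "C x = c *\<^sub>R x - G *v x" for x
  define s where "s x = (\<Sum>i\<in>UNIV. C x $ i)" for x
  have c: "G $ i $ i < c" for i
    using member_le_sum[of i UNIV "\<lambda>i. \<bar>G $ i $ i\<bar>"] by (simp add: c_def)
  have C_ge: "(c - G $ i $ i) * x $ i \<le> C x $ i" if "x \<in> K" for x i
    using Z_matrix_mult_le[OF Z, of x i] that by (simp add: C_def K_def algebra_simps)
  have C_nonneg: "0 \<le> C x $ i" if "x \<in> K" for x i
    using C_ge[OF that, of i] c[of i] that
    by (smt (verit) K_def mem_Collect_eq mult_nonneg_nonneg)
  have s: "0 < s x" if "x \<in> K" for x
  proof -
    have "x \<noteq> 0"
      using that by (auto simp: K_def)
    then obtain i where "x $ i \<noteq> 0"
      by (auto simp: vec_eq_iff)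
    hence "0 < x $ i"
      using that by (simp add: K_def less_le)
    hence "0 < (c - G $ i $ i) * x $ i"
      using c[of i] by simp
    hence "0 < C x $ i"
      using C_ge[OF that, of i] by linarith
    thus ?thesis
      unfolding s_def using C_nonneg[OF that] by (intro sum_pos2[of UNIV i]) auto
  qed
  have "compact K" "convex K"
    using compact_probability_vectors convex_probability_vectors by (simp_all add: K_def)
  moreover have "axis undefined 1 \<in> K"
    by (auto simp: K_def axis_def)
  hence "K \<noteq> {}"
    by blast
  moreover have "continuous_on K (\<lambda>x. (1 / s x) *\<^sub>R C x)"
    unfolding s_def C_def
    by (intro continuous_intros linear_continuous_on matrix_vector_mul_bounded_linear)
      (use s in \<open>force simp: s_def C_def\<close>)
  moreover have "(\<lambda>x. (1 / s x) *\<^sub>R C x) \<in> K \<rightarrow> K"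
  proof
    fix x assume x: "x \<in> K"
    have "(\<Sum>i\<in>UNIV. ((1 / s x) *\<^sub>R C x) $ i) = (1 / s x) * s x"
      by (simp add: s_def sum_distrib_left flip: sum_divide_distrib)
    thus "(1 / s x) *\<^sub>R C x \<in> K"
      using s[OF x] C_nonneg[OF x] by (simp add: K_def)
  qed
  ultimately obtain x where x: "x \<in> K" "(1 / s x) *\<^sub>R C x = x"
    by (rule brouwer)
  \<comment> \<open>Undoing the normalization at the fixed point gives the eigenvalue
    \<open>s x\<close> of \<open>C\<close>, hence \<open>c - s x\<close> of
    \<open>G\<close>.\<close>
  have "C x = s x *\<^sub>R ((1 / s x) *\<^sub>R C x)"
    using s[OF x(1)] by simp
  also have "\<dots> = s x *\<^sub>R x"
    by (simp only: x(2))
  finally have "C x = s x *\<^sub>R x" .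
  hence "G *v x = (c - s x) *\<^sub>R x"
    by (simp add: C_def algebra_simps)
  thus ?thesis
    using x(1) by (intro that[of x "c - s x"]) (auto simp: K_def)
qed

text \<open>With \<open>t\<close> the least ratio and \<open>z = y - t *\<^sub>R x\<close>, at each
  zero of \<open>z\<close> the entry of \<open>G *v z\<close> equals \<open>(s - r) * y $ i\<close>,
  which is nonnegative because \<open>r \<le> s\<close>. So \<open>z\<close> would be strictly
  positive unless it is zero, and the normalization gives \<open>t = 1\<close>.\<close>

lemma Perron_vector_unique_if_le:
  fixes G :: "real^'n^'n"
  assumes irr: "irreducible_matrix G" and Z: "Z_matrix G"
    and x: "pos_vec x" "(\<Sum>i\<in>UNIV. x $ i) = 1" "G *v x = r *\<^sub>R x"
    and y: "pos_vec y" "(\<Sum>i\<in>UNIV. y $ i) = 1" "G *v y = s *\<^sub>R y" and "r \<le> s"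
  shows "x = y"
proof -
  obtain t k where t: "\<And>i. t * x $ i \<le> y $ i" and k: "t * x $ k = y $ k"
    using ex_min_ratio[OF x(1)] by metis
  define z where "z = y - t *\<^sub>R x"
  have Gz: "G *v z = s *\<^sub>R y - (t * r) *\<^sub>R x"
    by (simp add: z_def matrix_vector_mult_diff_distrib matrix_vector_mult_scaleR x y)
  have "z = 0"
  proof (rule ccontr)
    assume "z \<noteq> 0"
    have "0 \<le> (G *v z) $ i" if "z $ i = 0" for i
    proof -
      have "t * x $ i = y $ i"
        using that by (simp add: z_def)
      hence "(G *v z) $ i = (s - r) * y $ i"
        by (simp add: Gz left_diff_distrib mult.commute[of t] mult.assoc)
      thus ?thesis
        using \<open>r \<le> s\<close> y(1) by (simp add: pos_vec_def less_imp_le)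
    qed
    hence "pos_vec z"
      using t \<open>z \<noteq> 0\<close> by (intro irreducible_Z_matrix_pos_vec[OF irr Z]) (auto simp: z_def)
    moreover have "z $ k = 0"
      using k by (simp add: z_def)
    ultimately show False
      by (metis less_irrefl pos_vec_def)
  qed
  hence "y = t *\<^sub>R x"
    by (simp add: z_def)
  moreover from this have "t = 1"
    using x(2) y(2) by (simp flip: sum_distrib_left)
  ultimately show ?thesis
    by simp
qed

text \<open>One of \<open>r \<le> s\<close> and \<open>s \<le> r\<close> holds, and the roles of the
  two pairs are symmetric.\<close>

lemma Perron_pair_unique:
  fixes G :: "real^'n^'n"
  assumes G: "irreducible_matrix G" "Z_matrix G"
    and x: "pos_vec x" "(\<Sum>i\<in>UNIV. x $ i) = 1" "G *v x = r *\<^sub>R x"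
    and y: "pos_vec y" "(\<Sum>i\<in>UNIV. y $ i) = 1" "G *v y = s *\<^sub>R y"
  shows "x = y \<and> r = s"
proof -
  have "x = y"
    using Perron_vector_unique_if_le[OF G x y] Perron_vector_unique_if_le[OF G y x] by fastforce
  moreover from this have "r *\<^sub>R x = s *\<^sub>R x"
    by (metis x(3) y(3))
  moreover have "x \<noteq> 0"
    using x(2) by auto
  ultimately show ?thesis
    by simp
qed

section \<open>Real eigenvalues of nonsingular M-matrices\<close>

lemma eigenvalue_of_real:
  fixes G :: "real^'n^'n"
  assumes "x \<noteq> 0" and "G *v x = \<tau> *\<^sub>R x"
  shows "eigenvalue_of G (of_real \<tau>)"
proof -
  have "map_matrix complex_of_real G *v (\<chi> i. of_real (x $ i)) = of_real \<tau> *s (\<chi> i. of_real (x $ i))"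
    using arg_cong[OF assms(2), of "\<lambda>u. of_real (u $ i) :: complex" for i]
    by (simp add: vec_eq_iff matrix_vector_mult_def map_matrix_def)
  moreover have "(\<chi> i. complex_of_real (x $ i)) \<noteq> 0"
    using assms(1) by (auto simp: vec_eq_iff)
  ultimately show ?thesis
    unfolding eigenvalue_of_def by blast
qed

text \<open>Subtracting \<open>G $ i $ i\<close> on the diagonal makes row \<open>i\<close> zero, so
  the result misses \<open>axis i 1\<close> and is singular. This controls diagonal entries of
  \<open>g Y \<mu>\<close> before \<open>\<mu>\<close> is known to be positive.\<close>

lemma eigenvalue_of_diag_row:
  fixes G :: "real^'n^'n"
  assumes "\<And>j. j \<noteq> i \<Longrightarrow> G $ i $ j = 0"
  shows "eigenvalue_of G (of_real (G $ i $ i))"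
proof -
  define H where "H = G - G $ i $ i *\<^sub>R mat 1"
  have Hx: "H *v x = G *v x - G $ i $ i *\<^sub>R x" for x
    by (simp add: H_def matrix_vector_mult_diff_rdistrib scaleR_matrix_vector_assoc[symmetric])
  have "(H *v x) $ i = 0" for x
    using assms by (auto simp: Hx matrix_vector_mult_diag_split intro!: sum.neutral)
  hence "H *v x \<noteq> axis i 1" for x
    by (metis axis_nth zero_neq_one)
  hence "\<not> invertible H"
    by (metis matrix_inv_mult_vec_eq_iff)
  then obtain x where "x \<noteq> 0" "H *v x = 0"
    by (auto simp: invertible_iff_ker)
  thus ?thesis
    by (intro eigenvalue_of_real) (auto simp: Hx)
qed

lemma invertible_M_matrix_real_eigenvalue:
  fixes G :: "real^'n^'n"
  assumes "invertible G" and "M_matrix G" and "eigenvalue_of G (of_real \<tau>)"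
  shows "0 < \<tau>"
proof -
  obtain v where v: "v \<noteq> 0" "map_matrix complex_of_real G *v v = of_real \<tau> *s v"
    using assms(3) by (auto simp: eigenvalue_of_def)
  have "0 \<le> \<tau>"
    using assms by (force simp: M_matrix_def)
  moreover have "\<tau> \<noteq> 0"
  proof
    assume "\<tau> = 0"
    have eq: "(\<Sum>j\<in>UNIV. of_real (G $ i $ j) * v $ j) = 0" for i
      using arg_cong[OF v(2), of "\<lambda>u. u $ i"] \<open>\<tau> = 0\<close>
      by (simp add: matrix_vector_mult_def map_matrix_def)
    \<comment> \<open>Since \<open>G\<close> is real, the real and imaginary parts of a complex null
      vector are null vectors themselves.\<close>
    have "G *v (\<chi> j. Re (v $ j)) = 0" "G *v (\<chi> j. Im (v $ j)) = 0"
      using arg_cong[OF eq, of Re] arg_cong[OF eq, of Im]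
      by (simp_all add: vec_eq_iff matrix_vector_mult_def)
    hence "(\<chi> j. Re (v $ j)) = 0" "(\<chi> j. Im (v $ j)) = 0"
      using assms(1) by (simp_all add: invertible_iff_ker)
    hence "v = 0"
      by (simp add: vec_eq_iff complex_eq_iff)
    thus False
      using v(1) by simp
  qed
  ultimately show ?thesis
    by simp
qed

text \<open>The Perron vector is the witness: its eigenvalue \<open>\<tau>\<close> is positive by
  the M-matrix property and nonsingularity.\<close>

lemma invertible_M_matrix_semipositive:
  fixes G :: "real^'n^'n"
  assumes irr: "irreducible_matrix G" and "invertible G" and "M_matrix G"
  obtains x where "pos_vec x" "\<And>i. 0 \<le> (G *v x) $ i" "G *v x \<noteq> 0"
proof -
  have Z: "Z_matrix G"
    using assms(3) by (simp add: M_matrix_def)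
  obtain \<tau> x where x: "\<And>i. 0 \<le> x $ i" "(\<Sum>i\<in>UNIV. x $ i) = 1" "G *v x = \<tau> *\<^sub>R x"
    using Z_matrix_Perron_vector[OF Z] by metis
  have "x \<noteq> 0"
    using x(2) by auto
  hence "0 < \<tau>"
    using invertible_M_matrix_real_eigenvalue[OF assms(2,3)] eigenvalue_of_real x(3) by blast
  moreover have "pos_vec x"
    by (rule irreducible_Z_matrix_pos_vec[OF irr Z]) (use x(1,3) \<open>x \<noteq> 0\<close> in auto)
  ultimately show ?thesis
    using x \<open>x \<noteq> 0\<close> by (intro that) auto
qed

section \<open>The parametrization\<close>

lemma diag_of_mult_nth: "(diag_of x ** A) $ i $ j = x $ i * A $ i $ j"
  by (simp add: diag_of_def matrix_matrix_mult_def if_distrib[of "\<lambda>a. a * _"] cong: if_cong)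

text \<open>Serves the continuity of the parametrization through Cramer's rule.\<close>

lemma continuous_on_det:
  fixes F :: "'a::topological_space \<Rightarrow> real^'k^'k"
  assumes "\<And>i j. continuous_on S (\<lambda>x. F x $ i $ j)"
  shows "continuous_on S (\<lambda>x. det (F x))"
  unfolding det_def by (intro continuous_intros assms)

section \<open>Signs in the network matrices\<close>

locale power_grid =
  fixes Y :: "real^('n::finite + 'm::finite)^('n + 'm)" and V\<^sub>S :: "real^'m"
  assumes kirchhoff: "kirchhoff_matrix Y"
    and irreducible_LL: "irreducible_matrix (Y_LL Y)"
    and pos_source: "pos_vec V\<^sub>S"
begin

abbreviation A :: "real^'n^'n" where "A \<equiv> Y_LL Y"
abbreviation b :: "real^'n" where "b \<equiv> I_star Y V\<^sub>S"

lemma Z_LL: "Z_matrix A"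
  using kirchhoff by (simp add: kirchhoff_matrix_def Z_matrix_def Y_LL_def)

lemma Y_LS_nonpos: "Y_LS Y $ i $ j \<le> 0"
  using kirchhoff by (simp add: kirchhoff_matrix_def Y_LS_def)

text \<open>Without an edge between loads and sources, a path starting at a load would visit loads
  only, against connectivity. The two occurrences of \<open>undefined\<close> name an arbitrary load
  and an arbitrary source.\<close>

lemma Y_LS_nonzero: "\<exists>i j. Y_LS Y $ i $ j \<noteq> 0"
proof (rule ccontr)
  assume none: "\<not> (\<exists>i j. Y_LS Y $ i $ j \<noteq> 0)"
  have "\<exists>i. k = Inl i" if "(Inl undefined, k) \<in> {(a, b). a \<noteq> b \<and> Y $ a $ b \<noteq> 0}\<^sup>*" for k
    using that
  proof (induction rule: rtrancl_induct)
    case (step k l)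
    thus ?case
      using none by (cases l) (auto simp: Y_LS_def)
  qed auto
  from this[of "Inr undefined"] show False
    using kirchhoff by (auto simp: kirchhoff_matrix_def)
qed

text \<open>Used twice: \<open>u = V\<^sub>S\<close> yields the signs of \<open>b\<close>, and
  \<open>u = 1\<close> those of \<open>A *v 1\<close>.\<close>

lemma neg_Y_LS_mult_pos:
  assumes "pos_vec u"
  shows "0 \<le> (- (Y_LS Y *v u)) $ i" and "\<exists>i. 0 < (- (Y_LS Y *v u)) $ i"
proof -
  have le: "0 \<le> - (Y_LS Y $ i $ j * u $ j)" for i j
    using Y_LS_nonpos[of i j] assms by (simp add: pos_vec_def mult_nonpos_nonneg less_imp_le)
  have eq: "(- (Y_LS Y *v u)) $ i = (\<Sum>j\<in>UNIV. - (Y_LS Y $ i $ j * u $ j))" for i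
    by (simp add: matrix_vector_mult_def sum_negf)
  show "0 \<le> (- (Y_LS Y *v u)) $ i"
    unfolding eq using le by (rule sum_nonneg)
  obtain i j where "Y_LS Y $ i $ j \<noteq> 0"
    using Y_LS_nonzero by blast
  hence "0 < - (Y_LS Y $ i $ j * u $ j)"
    using le[of i j] assms by (metis less_irrefl mult_eq_0_iff neg_equal_0_iff_equal order_less_le pos_vec_def)
  hence "0 < (- (Y_LS Y *v u)) $ i"
    unfolding eq using le by (intro sum_pos2[of UNIV j]) auto
  thus "\<exists>i. 0 < (- (Y_LS Y *v u)) $ i" ..
qed

lemma I_star_nonneg: "0 \<le> b $ i"
  using neg_Y_LS_mult_pos(1)[OF pos_source] by (simp add: I_star_def)

lemma I_star_pos: "\<exists>i. 0 < b $ i"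
  using neg_Y_LS_mult_pos(2)[OF pos_source] by (simp add: I_star_def)

lemma LL_mult_1: "A *v 1 = - (Y_LS Y *v 1)"
proof -
  have "(A *v 1) $ i + (Y_LS Y *v 1) $ i = 0" for i
  proof -
    \<comment> \<open>The index set is written as a disjoint sum so that the zero row sum splits
      into loads and sources.\<close>
    have "(\<Sum>j\<in>UNIV <+> UNIV. Y $ Inl i $ j) = 0"
      using kirchhoff by (simp add: kirchhoff_matrix_def)
    thus ?thesis
      by (subst (asm) sum.Plus) (simp_all add: matrix_vector_mult_def Y_LL_def Y_LS_def comp_def)
  qed
  thus ?thesis
    by (simp add: vec_eq_iff eq_neg_iff_add_eq_0)
qed

lemma LL_mult_1_nonneg: "0 \<le> (A *v 1) $ i"
  unfolding LL_mult_1 by (rule neg_Y_LS_mult_pos) (simp add: pos_vec_def)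

lemma LL_mult_1_nonzero: "A *v 1 \<noteq> 0"
proof -
  have "\<exists>i. 0 < (A *v 1) $ i"
    unfolding LL_mult_1 by (rule neg_Y_LS_mult_pos) (simp add: pos_vec_def)
  thus ?thesis
    by force
qed

lemma LL_diag_nonneg: "0 \<le> A $ i $ i"
  using Z_matrix_mult_le[OF Z_LL, of 1 i] LL_mult_1_nonneg[of i] by simp

text \<open>The all-ones vector is a semipositivity witness for \<open>A\<close>, which is therefore
  invertible.\<close>

lemma LL_mult_V_star: "A *v V_star Y V\<^sub>S = b"
proof -
  have "invertible A"
    using LL_mult_1_nonneg LL_mult_1_nonzero
    by (intro semipositive_invertible[OF irreducible_LL Z_LL, of 1]) (simp_all add: pos_vec_def)
  thus ?thesis
    using matrix_inv_mult_vec_eq_iff V_star_def by metis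
qed

section \<open>The matrix \<open>g Y \<mu>\<close> and the negated Jacobian\<close>

lemma g_nth: "g Y \<mu> $ i $ j = \<mu> $ i * A $ i $ j + (if i = j then (A *v \<mu>) $ i else 0)"
  by (simp add: g_def diag_of_mult_nth) (simp add: diag_of_def)

lemma g_mult_vec: "(g Y \<mu> *v V) $ i = \<mu> $ i * (A *v V) $ i + (A *v \<mu>) $ i * V $ i"
  by (simp add: g_def matrix_vector_mult_add_rdistrib diag_of_mult_vec
      matrix_vector_mul_assoc[symmetric])

lemma
  assumes "pos_vec \<mu>"
  shows irreducible_g: "irreducible_matrix (g Y \<mu>)" and Z_matrix_g: "Z_matrix (g Y \<mu>)"
  using irreducible_matrix_off_diag_scaled[OF irreducible_LL assms]
    Z_matrix_off_diag_scaled[OF Z_LL assms] by (simp_all add: g_nth)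

text \<open>This is \<open>- J(V)\<close>, simplified by \<open>A *v V_star Y V\<^sub>S = b\<close>;
  the sign makes it a Z-matrix for positive \<open>V\<close>.\<close>

definition neg_jac :: "real^'n \<Rightarrow> real^'n^'n" where
  "neg_jac V = diag_of V ** A + diag_of (A *v V - b)"

lemma jacobian_eq: "jacobian (P_c Y V\<^sub>S) (at V) = - neg_jac V"
  by (simp add: jacobian_P_c neg_jac_def matrix_vector_mult_diff_distrib LL_mult_V_star
      vec_eq_iff diag_of_def)

lemma neg_jac_nth: "neg_jac V $ i $ j = V $ i * A $ i $ j + (if i = j then (A *v V - b) $ i else 0)"
  by (simp add: neg_jac_def diag_of_mult_nth) (simp add: diag_of_def)

lemma neg_jac_mult_vec: "(neg_jac V *v x) $ i = V $ i * (A *v x) $ i + ((A *v V) $ i - b $ i) * x $ i"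
  by (simp add: neg_jac_def matrix_vector_mult_add_rdistrib diag_of_mult_vec
      matrix_vector_mul_assoc[symmetric])

lemma
  assumes "pos_vec V"
  shows irreducible_neg_jac: "irreducible_matrix (neg_jac V)" and Z_matrix_neg_jac: "Z_matrix (neg_jac V)"
  using irreducible_matrix_off_diag_scaled[OF irreducible_LL assms]
    Z_matrix_off_diag_scaled[OF Z_LL assms] by (simp_all add: neg_jac_nth)

text \<open>Replaces the condition on the inverse by strict inequalities in \<open>V\<close> and
  \<open>w\<close>, from which openness can be read off.\<close>

lemma stable_set_iff:
  "V \<in> stable_set Y V\<^sub>S \<longleftrightarrow> pos_vec V \<and> (\<exists>w. pos_vec w \<and> pos_vec (neg_jac V *v w))"
proof (cases "pos_vec V")
  case True
  thus ?thesis
    using neg_inverse_iff_semipositive[of "- neg_jac V"] irreducible_neg_jac Z_matrix_neg_jac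
    by (simp add: stable_set_def jacobian_eq)
qed (simp add: stable_set_def)

text \<open>Free of inverses, so that the equation passes to limits. The 1-norm appears as a plain
  sum because \<open>\<mu>\<close> is positive.\<close>

definition param_rel :: "real^'n \<Rightarrow> real \<Rightarrow> real^'n \<Rightarrow> bool" where
  "param_rel \<mu> r V \<longleftrightarrow> pos_vec \<mu> \<and> pos_vec V \<and> (\<Sum>i\<in>UNIV. \<mu> $ i) = 1 \<and>
     g Y \<mu> *v V = diag_of \<mu> *v (b + r *\<^sub>R 1)"

text \<open>\<open>g Y \<mu> *v V\<close> is symmetric in \<open>\<mu>\<close> and \<open>V\<close>;
  moving the terms \<open>\<mu> $ i * b $ i\<close> to the left turns it into
  \<open>neg_jac V *v \<mu>\<close>.\<close>

lemma g_mult_eq_iff_eigenvector: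
  "g Y \<mu> *v V = diag_of \<mu> *v (b + r *\<^sub>R 1) \<longleftrightarrow> neg_jac V *v \<mu> = r *\<^sub>R \<mu>"
  unfolding vec_eq_iff g_mult_vec neg_jac_mult_vec
  by (intro all_cong1) (auto simp: diag_of_mult_vec algebra_simps)

text \<open>If \<open>\<mu> $ i < 0\<close>, the signs of two Z-matrices make row \<open>i\<close>
  of \<open>A\<close> vanish off the diagonal, and then the eigenvalue
  \<open>2 * \<mu> $ i * A $ i $ i\<close> of \<open>g Y \<mu>\<close> would be positive despite
  \<open>0 \<le> A $ i $ i\<close>. If \<open>\<mu> $ i = 0\<close>, row \<open>i\<close> of
  \<open>g Y \<mu>\<close> is again diagonal, with entry
  \<open>(A *v \<mu>) $ i \<le> 0\<close>.\<close>

lemma pos_vec_M_set: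
  assumes "\<mu> \<in> M_set Y"
  shows "pos_vec \<mu>"
proof -
  have G: "invertible (g Y \<mu>)" "M_matrix (g Y \<mu>)"
    using assms by (simp_all add: M_set_def)
  have diag: "0 < \<mu> $ i * A $ i $ i + (A *v \<mu>) $ i" if "\<And>j. j \<noteq> i \<Longrightarrow> \<mu> $ i * A $ i $ j = 0" for i
    using invertible_M_matrix_real_eigenvalue[OF G eigenvalue_of_diag_row[of i]] that
    by (simp add: g_nth)
  have nonneg: "0 \<le> \<mu> $ i" for i
  proof (rule ccontr)
    assume "\<not> 0 \<le> \<mu> $ i"
    hence neg: "\<mu> $ i < 0"
      by simp
    have "A $ i $ j = 0" if "j \<noteq> i" for j
    proof -
      have "g Y \<mu> $ i $ j \<le> 0" "A $ i $ j \<le> 0"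
        using G(2) Z_LL that by (auto simp: M_matrix_def Z_matrix_def)
      thus ?thesis
        using neg that by (simp add: g_nth mult_le_0_iff)
    qed
    moreover from this have "(A *v \<mu>) $ i = A $ i $ i * \<mu> $ i"
      by (simp add: matrix_vector_mult_diag_split)
    ultimately have "0 < 2 * (\<mu> $ i * A $ i $ i)"
      using diag[of i] by simp
    thus False
      using neg LL_diag_nonneg[of i] by (simp add: zero_less_mult_iff)
  qed
  have "\<mu> $ i \<noteq> 0" for i
  proof
    assume "\<mu> $ i = 0"
    thus False
      using diag[of i] Z_matrix_mult_le[OF Z_LL nonneg, of i] by simp
  qed
  thus ?thesis
    using nonneg by (simp add: pos_vec_def less_le)
qed

definition param :: "(real^'n) \<times> real \<Rightarrow> real^'n" where
  "param = (\<lambda>(\<mu>, r). (matrix_inv (g Y \<mu>) ** diag_of \<mu>) *v (b + r *\<^sub>R 1))"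

lemma param_eq_iff:
  assumes "\<mu> \<in> M1_set Y"
  shows "V = param (\<mu>, r) \<longleftrightarrow> g Y \<mu> *v V = diag_of \<mu> *v (b + r *\<^sub>R 1)"
  using assms matrix_inv_mult_vec_eq_iff[of "g Y \<mu>"]
  by (simp add: param_def M1_set_def M_set_def matrix_vector_mul_assoc[symmetric])

lemma diag_of_mult_I_star_plus:
  assumes "pos_vec \<mu>" "0 \<le> r"
  shows "0 \<le> (diag_of \<mu> *v (b + r *\<^sub>R 1)) $ i" and "diag_of \<mu> *v (b + r *\<^sub>R 1) \<noteq> 0"
proof -
  show "0 \<le> (diag_of \<mu> *v (b + r *\<^sub>R 1)) $ i"
    using assms I_star_nonneg[of i] by (simp add: diag_of_mult_vec pos_vec_def less_imp_le)
  obtain i where "0 < b $ i"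
    using I_star_pos by blast
  hence "0 < (diag_of \<mu> *v (b + r *\<^sub>R 1)) $ i"
    using assms by (simp add: diag_of_mult_vec pos_vec_def)
  thus "diag_of \<mu> *v (b + r *\<^sub>R 1) \<noteq> 0"
    by force
qed

text \<open>From left to right, \<open>V\<close> itself is a semipositivity witness for
  \<open>g Y \<mu>\<close>, making it a nonsingular M-matrix. From right to left, the M-matrix
  property supplies some witness, and \<open>semipositive_pos_vec\<close> transfers positivity to
  \<open>V\<close>.\<close>

lemma param_rel_iff:
  assumes "0 \<le> r"
  shows "param_rel \<mu> r V \<longleftrightarrow> \<mu> \<in> M1_set Y \<and> V = param (\<mu>, r)"
proof
  assume rel: "param_rel \<mu> r V"
  hence pos: "pos_vec \<mu>" "pos_vec V" and eq: "g Y \<mu> *v V = diag_of \<mu> *v (b + r *\<^sub>R 1)"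
    and sum1: "(\<Sum>i\<in>UNIV. \<mu> $ i) = 1"
    by (auto simp: param_rel_def)
  note rhs = diag_of_mult_I_star_plus[OF pos(1) assms, folded eq]
  have "norm_1 \<mu> = 1"
    using sum1 pos(1) by (simp add: norm_1_def pos_vec_def less_imp_le)
  hence "\<mu> \<in> M1_set Y"
    using semipositive_invertible[OF irreducible_g[OF pos(1)] Z_matrix_g[OF pos(1)] pos(2) rhs]
      semipositive_M_matrix[OF Z_matrix_g[OF pos(1)] pos(2) rhs(1)]
    by (simp add: M1_set_def M_set_def)
  thus "\<mu> \<in> M1_set Y \<and> V = param (\<mu>, r)"
    using eq by (simp add: param_eq_iff)
next
  assume *: "\<mu> \<in> M1_set Y \<and> V = param (\<mu>, r)"
  hence pos: "pos_vec \<mu>" and G: "invertible (g Y \<mu>)" "M_matrix (g Y \<mu>)"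
    using pos_vec_M_set by (auto simp: M1_set_def M_set_def)
  have eq: "g Y \<mu> *v V = diag_of \<mu> *v (b + r *\<^sub>R 1)"
    using * param_eq_iff by blast
  note rhs = diag_of_mult_I_star_plus[OF pos assms, folded eq]
  obtain x where x: "pos_vec x" "\<And>i. 0 \<le> (g Y \<mu> *v x) $ i" "g Y \<mu> *v x \<noteq> 0"
    using invertible_M_matrix_semipositive[OF irreducible_g[OF pos] G] by metis
  have "V \<noteq> 0"
    using rhs(2) by auto
  hence "pos_vec V"
    by (intro semipositive_pos_vec[OF irreducible_g[OF pos] Z_matrix_g[OF pos] x rhs(1)])
  moreover have "(\<Sum>i\<in>UNIV. \<mu> $ i) = 1"
    using * pos by (simp add: M1_set_def norm_1_def pos_vec_def less_imp_le)
  ultimately show "param_rel \<mu> r V"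
    using pos eq by (simp add: param_rel_def)
qed

lemma stable_set_iff_param_rel: "V \<in> stable_set Y V\<^sub>S \<longleftrightarrow> (\<exists>\<mu> r. 0 < r \<and> param_rel \<mu> r V)"
proof
  assume "V \<in> stable_set Y V\<^sub>S"
  then obtain w where V: "pos_vec V" and w: "pos_vec w" "pos_vec (neg_jac V *v w)"
    by (auto simp: stable_set_iff)
  note irr = irreducible_neg_jac[OF V] and Z = Z_matrix_neg_jac[OF V]
  obtain r \<mu> where \<mu>: "\<And>i. 0 \<le> \<mu> $ i" "(\<Sum>i\<in>UNIV. \<mu> $ i) = 1" "neg_jac V *v \<mu> = r *\<^sub>R \<mu>"
    using Z_matrix_Perron_vector[OF Z] by metis
  have "\<mu> \<noteq> 0"
    using \<mu>(2) by auto
  hence pos: "pos_vec \<mu>"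
    by (intro irreducible_Z_matrix_pos_vec[OF irr Z]) (use \<mu>(1,3) in auto)
  have "0 < r"
  proof (rule ccontr)
    assume "\<not> 0 < r"
    \<comment> \<open>For \<open>r \<le> 0\<close> the vector \<open>- \<mu>\<close> would have a
      nonnegative image and hence be positive, since \<open>w\<close> is a witness.\<close>
    have "neg_jac V *v (- \<mu>) = - r *\<^sub>R \<mu>"
      by (simp add: linear_neg[OF matrix_vector_mul_linear] \<mu>(3))
    hence "pos_vec (- \<mu>)"
      using \<open>\<not> 0 < r\<close> \<mu>(1) w(2) \<open>\<mu> \<noteq> 0\<close>
      by (intro semipositive_pos_vec[OF irr Z w(1)])
        (auto simp: pos_vec_def less_imp_le mult_nonpos_nonneg)
    hence "0 < (- \<mu>) $ undefined"
      by (simp only: pos_vec_def)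
    thus False
      using \<mu>(1)[of undefined] by simp
  qed
  thus "\<exists>\<mu> r. 0 < r \<and> param_rel \<mu> r V"
    using pos V \<mu>(2,3) by (auto simp: param_rel_def g_mult_eq_iff_eigenvector)
next
  assume "\<exists>\<mu> r. 0 < r \<and> param_rel \<mu> r V"
  then obtain \<mu> r where "0 < r" and rel: "param_rel \<mu> r V"
    by blast
  hence "pos_vec (neg_jac V *v \<mu>)"
    by (simp add: param_rel_def g_mult_eq_iff_eigenvector pos_vec_def)
  thus "V \<in> stable_set Y V\<^sub>S"
    using rel by (auto simp: stable_set_iff param_rel_def)
qed

lemma param_rel_unique:
  assumes "param_rel \<mu> r V" and "param_rel \<nu> s V"
  shows "\<mu> = \<nu> \<and> r = s"
  using assms
  by (intro Perron_pair_unique[of "neg_jac V"] irreducible_neg_jac Z_matrix_neg_jac)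
    (auto simp: param_rel_def g_mult_eq_iff_eigenvector)

text \<open>Bounding \<open>(A *v \<mu>) $ i\<close> by \<open>A $ i $ i * \<mu> $ i\<close> lets
  \<open>\<mu> $ i\<close> cancel. The bound thus survives a limit in which \<open>\<mu> $ i\<close>
  might tend to 0.\<close>

lemma param_rel_lower_bound:
  assumes "param_rel \<mu> r V"
  shows "b $ i + r \<le> A $ i $ i * V $ i + (A *v V) $ i"
proof -
  have pos: "0 < \<mu> $ j" "0 < V $ j" for j
    using assms by (auto simp: param_rel_def pos_vec_def)
  have "\<mu> $ i * (b $ i + r) = \<mu> $ i * (A *v V) $ i + (A *v \<mu>) $ i * V $ i"
    using assms by (simp add: param_rel_def diag_of_mult_vec flip: g_mult_vec)
  also have "\<dots> \<le> \<mu> $ i * (A *v V) $ i + (A $ i $ i * \<mu> $ i) * V $ i"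
    using Z_matrix_mult_le[OF Z_LL, of \<mu> i] pos
    by (intro add_left_mono mult_right_mono) (auto simp: less_imp_le)
  finally have "\<mu> $ i * (b $ i + r) \<le> \<mu> $ i * (A $ i $ i * V $ i + (A *v V) $ i)"
    by (simp add: algebra_simps)
  thus ?thesis
    using pos(1)[of i] by simp
qed

text \<open>Limits of \<open>\<mu>\<close> and \<open>V\<close> are at first only nonnegative.
  Convergence of \<open>r\<close> comes from the equation, then the lower bound and irreducibility
  of \<open>A\<close> restore strict positivity, first of \<open>v\<close> and then of
  \<open>m\<close>.\<close>

lemma param_rel_limit:
  assumes rel: "\<And>k. param_rel (\<mu> k) (r k) (V k)" and r: "\<And>k. 0 \<le> r k"
    and lim: "\<mu> \<longlonglongrightarrow> m" "V \<longlonglongrightarrow> v"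
  obtains \<rho> where "r \<longlonglongrightarrow> \<rho>" "0 \<le> \<rho>" "param_rel m \<rho> v"
proof -
  have limA: "(\<lambda>k. (A *v \<mu> k) $ i) \<longlonglongrightarrow> (A *v m) $ i" "(\<lambda>k. (A *v V k) $ i) \<longlonglongrightarrow> (A *v v) $ i" for i
    using lim by (auto intro!: tendsto_vec_nth bounded_linear.tendsto[OF matrix_vector_mul_bounded_linear])
  have limc: "(\<lambda>k. \<mu> k $ i) \<longlonglongrightarrow> m $ i" "(\<lambda>k. V k $ i) \<longlonglongrightarrow> v $ i" for i
    using lim by (auto intro: tendsto_vec_nth)
  have pos: "0 < \<mu> k $ i" "0 < V k $ i" for k i
    using rel by (auto simp: param_rel_def pos_vec_def)
  have m: "0 \<le> m $ i" and v: "0 \<le> v $ i" for i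
    by (rule LIMSEQ_le_const[OF limc(1)], use pos in \<open>auto simp: less_imp_le\<close>,
        rule LIMSEQ_le_const[OF limc(2)], use pos in \<open>auto simp: less_imp_le\<close>)
  have sum1: "(\<Sum>i\<in>UNIV. m $ i) = 1"
  proof -
    have "(\<lambda>k. \<Sum>i\<in>UNIV. \<mu> k $ i) \<longlonglongrightarrow> (\<Sum>i\<in>UNIV. m $ i)"
      by (intro tendsto_sum limc)
    thus ?thesis
      using rel by (simp add: param_rel_def LIMSEQ_const_iff)
  qed
  have eq: "\<mu> k $ i * (A *v V k) $ i + (A *v \<mu> k) $ i * V k $ i = \<mu> k $ i * (b $ i + r k)" for k i
    using rel[of k] by (simp add: param_rel_def diag_of_mult_vec flip: g_mult_vec)
  \<comment> \<open>Adding up the rows of the equation and using that \<open>\<mu> k\<close> sums to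
    1 expresses \<open>r k\<close> by \<open>\<mu> k\<close> and \<open>V k\<close>;
    \<open>\<rho>\<close> is the same expression at the limit.\<close>
  define \<rho> where "\<rho> = (\<Sum>i\<in>UNIV. m $ i * (A *v v) $ i + (A *v m) $ i * v $ i - m $ i * b $ i)"
  have "r k = (\<Sum>i\<in>UNIV. \<mu> k $ i * (A *v V k) $ i + (A *v \<mu> k) $ i * V k $ i - \<mu> k $ i * b $ i)" for k
  proof -
    have "(\<Sum>i\<in>UNIV. \<mu> k $ i * r k) = r k"
      using rel[of k] by (simp add: param_rel_def flip: sum_distrib_right)
    thus ?thesis
      by (simp add: eq distrib_left)
  qed
  moreover have "(\<lambda>k. \<Sum>i\<in>UNIV. \<mu> k $ i * (A *v V k) $ i + (A *v \<mu> k) $ i * V k $ i - \<mu> k $ i * b $ i) \<longlonglongrightarrow> \<rho>"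
    unfolding \<rho>_def by (intro tendsto_intros limA limc)
  ultimately have lim_r: "r \<longlonglongrightarrow> \<rho>"
    by presburger
  have \<rho>: "0 \<le> \<rho>"
    using r by (intro tendsto_lowerbound[OF lim_r]) auto
  have lim_eq: "m $ i * (A *v v) $ i + (A *v m) $ i * v $ i = m $ i * (b $ i + \<rho>)" for i
  proof (rule LIMSEQ_unique)
    show "(\<lambda>k. \<mu> k $ i * (A *v V k) $ i + (A *v \<mu> k) $ i * V k $ i)
        \<longlonglongrightarrow> m $ i * (A *v v) $ i + (A *v m) $ i * v $ i"
      by (intro tendsto_intros limA limc)
    show "(\<lambda>k. \<mu> k $ i * (A *v V k) $ i + (A *v \<mu> k) $ i * V k $ i) \<longlonglongrightarrow> m $ i * (b $ i + \<rho>)"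
      unfolding eq by (intro tendsto_intros limc lim_r)
  qed
  have bound: "b $ i + \<rho> \<le> A $ i $ i * v $ i + (A *v v) $ i" for i
  proof (rule LIMSEQ_le)
    show "(\<lambda>k. b $ i + r k) \<longlonglongrightarrow> b $ i + \<rho>"
      by (intro tendsto_intros lim_r)
    show "(\<lambda>k. A $ i $ i * V k $ i + (A *v V k) $ i) \<longlonglongrightarrow> A $ i $ i * v $ i + (A *v v) $ i"
      by (intro tendsto_intros limA limc)
  qed (use param_rel_lower_bound[OF rel] in blast)
  have "v \<noteq> 0"
  proof
    assume "v = 0"
    hence "b $ i \<le> 0" for i
      using bound[of i] \<rho> by simp
    thus False
      using I_star_pos by (meson not_less)
  qed
  have vpos: "pos_vec v"
  proof (rule irreducible_Z_matrix_pos_vec[OF irreducible_LL Z_LL v _ \<open>v \<noteq> 0\<close>])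
    show "0 \<le> (A *v v) $ i" if "v $ i = 0" for i
      using bound[of i] \<rho> I_star_nonneg[of i] that by simp
  qed
  \<comment> \<open>Where \<open>m $ i = 0\<close>, the limit equation reads
    \<open>(A *v m) $ i * v $ i = 0\<close>, and \<open>v $ i\<close> is already known to be
    positive.\<close>
  have "pos_vec m"
  proof (rule irreducible_Z_matrix_pos_vec[OF irreducible_LL Z_LL m])
    show "0 \<le> (A *v m) $ i" if "m $ i = 0" for i
      using lim_eq[of i] that vpos by (simp add: pos_vec_def) (metis less_irrefl order_refl)
    show "m \<noteq> 0"
      using sum1 by auto
  qed
  moreover have "g Y m *v v = diag_of m *v (b + \<rho> *\<^sub>R 1)"
    by (simp add: vec_eq_iff g_mult_vec lim_eq diag_of_mult_vec)
  ultimately show ?thesis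
    using vpos sum1 by (intro that[OF lim_r \<rho>]) (simp add: param_rel_def)
qed

section \<open>Closure, frontier and homeomorphism\<close>

lemma stable_set_eq: "stable_set Y V\<^sub>S = param ` (M1_set Y \<times> {0<..})"
  by (force simp: stable_set_iff_param_rel param_rel_iff)

lemma inj_on_param: "inj_on param (M1_set Y \<times> {0..})"
proof (rule inj_onI)
  fix p q
  assume "p \<in> M1_set Y \<times> {0..}" "q \<in> M1_set Y \<times> {0..}" "param p = param q"
  hence "param_rel (fst p) (snd p) (param p)" "param_rel (fst q) (snd q) (param p)"
    by (auto simp: param_rel_iff)
  thus "p = q"
    using param_rel_unique by (blast intro: prod_eqI)
qed

lemma continuous_on_param: "continuous_on (M1_set Y \<times> {0..}) param"
proof -
  define rhs where "rhs p = diag_of (fst p) *v (b + snd p *\<^sub>R 1)" for p :: "(real^'n) \<times> real"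
  \<comment> \<open>Cramer's quotients for the system \<open>g Y (fst p) *v x = rhs p\<close>: they
    are visibly continuous in \<open>p\<close> and agree with \<open>param\<close> on the
    domain.\<close>
  define cr where "cr p = (\<chi> k. det (\<chi> i j. if j = k then rhs p $ i else g Y (fst p) $ i $ j) / det (g Y (fst p)))" for p
  have det: "det (g Y \<mu>) \<noteq> 0" if "\<mu> \<in> M1_set Y" for \<mu>
    using that by (simp add: M1_set_def M_set_def invertible_det_nz)
  have cont_g: "continuous_on S (\<lambda>p. g Y (fst p) $ i $ j)" for i j and S :: "((real^'n) \<times> real) set"
    unfolding g_nth matrix_vector_mult_def by (cases "i = j") (auto intro!: continuous_intros)
  have cont_rhs: "continuous_on S (\<lambda>p. rhs p $ i)" for i S
    unfolding rhs_def diag_of_mult_vec by (auto intro!: continuous_intros)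
  have "continuous_on (M1_set Y \<times> {0..}) cr"
    unfolding cr_def
  proof (intro continuous_on_vec_lambda continuous_on_divide continuous_on_det cont_g)
    fix k i j :: 'n
    show "continuous_on (M1_set Y \<times> {0..})
      (\<lambda>p. (\<chi> i j. if j = k then rhs p $ i else g Y (fst p) $ i $ j) $ i $ j)"
      by (cases "j = k") (simp_all add: cont_g cont_rhs)
  qed (use det in auto)
  moreover have "cr p = param p" if "p \<in> M1_set Y \<times> {0..}" for p
  proof -
    have "g Y (fst p) *v cr p = rhs p"
      using cramer[OF det, of "fst p" "cr p" "rhs p"] that by (auto simp: cr_def)
    thus ?thesis
      using param_eq_iff[of "fst p" "cr p" "snd p"] that by (auto simp: rhs_def)
  qed
  ultimately show ?thesis
    by (simp cong: continuous_on_cong)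
qed

text \<open>The vectors \<open>\<mu> k\<close> lie in the compact simplex, so a subsequence
  converges, and \<open>param_rel_limit\<close> supplies the limit of \<open>r\<close> and keeps the
  limit pair in the domain. Allowing any relatively closed \<open>U\<close> makes
  \<open>param\<close> a closed map.\<close>

lemma closed_param_image:
  assumes U: "closedin (top_of_set (M1_set Y \<times> {0..})) U"
  shows "closed (param ` U)"
  unfolding closed_sequential_limits
proof clarify
  fix V v assume V: "\<forall>k. V k \<in> param ` U" and lim: "V \<longlonglongrightarrow> v"
  have sub: "U \<subseteq> M1_set Y \<times> {0..}"
    using U by (rule closedin_imp_subset)
  have "\<exists>\<mu> r. (\<mu>, r) \<in> U \<and> V k = param (\<mu>, r)" for k
    using V by force
  then obtain \<mu> r where U\<mu>: "\<And>k. (\<mu> k, r k) \<in> U" and V\<mu>: "\<And>k. V k = param (\<mu> k, r k)"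
    by metis
  have r: "0 \<le> r k" and rel: "param_rel (\<mu> k) (r k) (V k)" for k
    using U\<mu>[of k] sub by (auto simp: param_rel_iff V\<mu>)
  have "\<mu> k \<in> {x. (\<forall>i. 0 \<le> x $ i) \<and> (\<Sum>i\<in>UNIV. x $ i) = 1}" for k
    using rel[of k] by (simp add: param_rel_def pos_vec_def less_imp_le)
  then obtain m \<sigma> where \<sigma>: "strict_mono (\<sigma> :: nat \<Rightarrow> nat)" and lim_\<mu>: "(\<mu> \<circ> \<sigma>) \<longlonglongrightarrow> m"
    using seq_compactE[OF compact_imp_seq_compact[OF compact_probability_vectors], of \<mu>] by blast
  have lim_V: "(V \<circ> \<sigma>) \<longlonglongrightarrow> v"
    using lim \<sigma> by (rule LIMSEQ_subseq_LIMSEQ)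
  obtain \<rho> where \<rho>: "(r \<circ> \<sigma>) \<longlonglongrightarrow> \<rho>" "0 \<le> \<rho>" "param_rel m \<rho> v"
    using param_rel_limit[of "\<mu> \<circ> \<sigma>" "r \<circ> \<sigma>" "V \<circ> \<sigma>", OF _ _ lim_\<mu> lim_V] rel r by auto
  have mS: "(m, \<rho>) \<in> M1_set Y \<times> {0..}" and v: "v = param (m, \<rho>)"
    using \<rho>(2,3) by (simp_all add: param_rel_iff)
  obtain C where C: "closed C" "U = C \<inter> (M1_set Y \<times> {0..})"
    using U by (auto simp: closedin_closed)
  have "(\<lambda>k. (\<mu> (\<sigma> k), r (\<sigma> k))) \<longlonglongrightarrow> (m, \<rho>)"
    using lim_\<mu> \<rho>(1) by (intro tendsto_Pair) (simp_all add: comp_def)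
  hence "(m, \<rho>) \<in> C"
    by (rule closed_sequentially[OF C(1), rotated]) (use U\<mu> C(2) in auto)
  thus "v \<in> param ` U"
    using mS v C(2) by blast
qed

lemma closure_stable_set: "closure (stable_set Y V\<^sub>S) = param ` (M1_set Y \<times> {0..})"
proof
  have "closed (param ` (M1_set Y \<times> {0..}))"
    by (intro closed_param_image) auto
  thus "closure (stable_set Y V\<^sub>S) \<subseteq> param ` (M1_set Y \<times> {0..})"
    by (intro closure_minimal) (auto simp: stable_set_eq)
next
  show "param ` (M1_set Y \<times> {0..}) \<subseteq> closure (stable_set Y V\<^sub>S)"
  proof (rule image_subsetI)
    fix p assume "p \<in> M1_set Y \<times> {0::real..}"
    then obtain \<mu> r where p: "p = (\<mu>, r)" and *: "\<mu> \<in> M1_set Y" "r \<in> {0..}"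
      by blast
    \<comment> \<open>A point with \<open>r \<ge> 0\<close> is approached with \<open>\<mu>\<close>
      fixed and \<open>r\<close> raised by \<open>1 / (k + 1)\<close>, which is positive for every
      \<open>k\<close>.\<close>
    have "(\<lambda>k. (matrix_inv (g Y \<mu>) ** diag_of \<mu>) *v (b + (r + inverse (real (Suc k))) *\<^sub>R 1))
        \<longlonglongrightarrow> (matrix_inv (g Y \<mu>) ** diag_of \<mu>) *v (b + (r + 0) *\<^sub>R 1)"
      by (intro bounded_linear.tendsto[OF matrix_vector_mul_bounded_linear] tendsto_intros
          LIMSEQ_inverse_real_of_nat)
    hence "(\<lambda>k. param (\<mu>, r + inverse (real (Suc k)))) \<longlonglongrightarrow> param (\<mu>, r)"
      by (simp add: param_def)
    moreover have "param (\<mu>, r + inverse (real (Suc k))) \<in> stable_set Y V\<^sub>S" for k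
      using * by (auto simp: stable_set_eq intro!: imageI add_nonneg_pos)
    ultimately show "param p \<in> closure (stable_set Y V\<^sub>S)"
      unfolding p closure_sequential by (intro exI conjI allI)
  qed
qed

text \<open>For each fixed \<open>w\<close>, the strict inequalities define an open set of
  \<open>V\<close>; the stable set is the union of these.\<close>

lemma open_stable_set: "open (stable_set Y V\<^sub>S)"
proof -
  have "stable_set Y V\<^sub>S = (\<Union>w\<in>Collect pos_vec. {V. pos_vec V \<and> pos_vec (neg_jac V *v w)})"
    by (auto simp: stable_set_iff)
  also have "open \<dots>"
    unfolding pos_vec_def neg_jac_mult_vec Collect_conj_eq Collect_all_eq
    unfolding matrix_vector_mult_def
    by (auto intro!: open_UN open_Int open_INT open_Collect_less continuous_intros)
  finally show ?thesis .
qed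

text \<open>By injectivity, removing the open stable set from its closure amounts to removing
  \<open>r > 0\<close> from the parameter domain.\<close>

lemma frontier_stable_set: "frontier (stable_set Y V\<^sub>S) = param ` (M1_set Y \<times> {0})"
proof -
  have "frontier (stable_set Y V\<^sub>S) = param ` (M1_set Y \<times> {0..}) - param ` (M1_set Y \<times> {0<..})"
    by (simp add: frontier_def interior_open open_stable_set closure_stable_set flip: stable_set_eq)
  also have "\<dots> = param ` (M1_set Y \<times> {0..} - M1_set Y \<times> {0<..})"
    by (intro inj_on_image_set_diff[OF inj_on_param, symmetric]) auto
  also have "M1_set Y \<times> {0..} - M1_set Y \<times> {0<..} = M1_set Y \<times> {0::real}"
    by auto
  finally show ?thesis .
qed

lemma param_homeomorphism:
  "\<exists>h. homeomorphism (M1_set Y \<times> {0..}) (closure (stable_set Y V\<^sub>S)) param h"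
proof -
  have "closedin (top_of_set (closure (stable_set Y V\<^sub>S))) (param ` U)"
    if "closedin (top_of_set (M1_set Y \<times> {0..})) U" for U
    using closed_param_image[OF that] closedin_imp_subset[OF that]
    by (intro closed_subset) (auto simp: closure_stable_set)
  thus ?thesis
    using homeomorphism_injective_closed_map[OF continuous_on_param closure_stable_set[symmetric] inj_on_param]
    by metis
qed

end

theorem theorem3p6:
  fixes Y :: "real^('n::finite + 'm::finite)^('n + 'm)" and V\<^sub>S :: "real^'m"
  assumes "kirchhoff_matrix Y"
    and "irreducible_matrix (Y_LL Y)"
    and "pos_vec V\<^sub>S"
  shows "stable_set Y V\<^sub>S =
           {(matrix_inv (g Y \<mu>) ** diag_of \<mu>) *v (I_star Y V\<^sub>S + r *\<^sub>R 1) | \<mu> r.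
              \<mu> \<in> M1_set Y \<and> r > 0} \<and>
         closure (stable_set Y V\<^sub>S) =
           {(matrix_inv (g Y \<mu>) ** diag_of \<mu>) *v (I_star Y V\<^sub>S + r *\<^sub>R 1) | \<mu> r.
              \<mu> \<in> M1_set Y \<and> r \<ge> 0} \<and>
         frontier (stable_set Y V\<^sub>S) =
           {(matrix_inv (g Y \<mu>) ** diag_of \<mu>) *v I_star Y V\<^sub>S | \<mu>. \<mu> \<in> M1_set Y} \<and>
         (\<exists>h. homeomorphism (M1_set Y \<times> {0..}) (closure (stable_set Y V\<^sub>S))
           (\<lambda>(\<mu>, r). (matrix_inv (g Y \<mu>) ** diag_of \<mu>) *v (I_star Y V\<^sub>S + r *\<^sub>R 1)) h)"
proof -
  interpret power_grid Y V\<^sub>S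
    using assms by unfold_locales
  have "stable_set Y V\<^sub>S = {param (\<mu>, r) | \<mu> r. \<mu> \<in> M1_set Y \<and> r > 0}"
    unfolding stable_set_eq by blast
  moreover have "closure (stable_set Y V\<^sub>S) = {param (\<mu>, r) | \<mu> r. \<mu> \<in> M1_set Y \<and> r \<ge> 0}"
    unfolding closure_stable_set by blast
  moreover have "frontier (stable_set Y V\<^sub>S) = {param (\<mu>, 0) | \<mu>. \<mu> \<in> M1_set Y}"
    unfolding frontier_stable_set by blast
  ultimately show ?thesis
    using param_homeomorphism unfolding param_def prod.case scaleR_zero_left add_0_right
    by (intro conjI)
qed

end
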